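(* The groups $\mathrm{Homeo}_{I_1}(\mathcal S)$ and $\widetilde{\mathrm{Homeo}}_+(\mathbb S^1)$ are isomorphic.
   Context: Universal one-dimensional solenoid: $\mathcal S=\varprojlim_n \mathbb R/n\mathbb Z$ (index set $\mathbb Z_+$ ordered by divisibility, bonding maps the canonical projections), a compact connected abelian topological group; $\mathbb S^1=\mathbb R/\mathbb Z$. $\mathrm{Homeo}_+(\mathbb S^1)$ is the group of orientation-preserving homeomorphisms of $\mathbb S^1$, and $\widetilde{\mathrm{Homeo}}_+(\mathbb S^1)$ is the group (under composition) of all homeomorphisms $\mathbb R\to\mathbb R$ that are lifts of elements of $\mathrm{Homeo}_+(\mathbb S^1)$, i.e. increasing homeomorphisms commuting with $x\mapsto x+1$. $\mathrm{Homeo}_{I_1}(\mathcal S)$ (induced homeomorphisms of degree 1) is the group under composition of homeomorphisms $f$ of $\mathcal S$ obtained as follows: given $f_1\in\mathrm{Homeo}_+(\mathbb S^1)$ and a lift $F_1:\mathbb R\to\mathbb R$ of $f_1$, let $f_n:\mathbb R/n\mathbb Z\to\mathbb R/n\mathbb Z$ be the projection of $F_1$ for each $n\ge1$; these are compatible with the bonding maps, and $f=\varprojlim f_n$. *)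

theory Defs
  imports "HOL-Analysis.Analysis" "HOL-Algebra.Bij"
begin

definition cong_mod :: "nat \<Rightarrow> (real \<times> real) set" where
  "cong_mod n = {(x, y). \<exists>k::int. y - x = of_int k * of_nat n}"

lemma equiv_cong_mod: "equiv UNIV (cong_mod n)"
proof (rule equivI)
  show "refl (cong_mod n)"
    by (auto simp: refl_on_def cong_mod_def intro: exI[of _ 0])
  show "sym (cong_mod n)"
  proof (rule symI)
    fix x y assume "(x, y) \<in> cong_mod n"
    then obtain k :: int where "y - x = of_int k * of_nat n"
      by (auto simp: cong_mod_def)
    then have "x - y = of_int (- k) * of_nat n" by simp
    then show "(y, x) \<in> cong_mod n" unfolding cong_mod_def by blast
  qed
  show "trans (cong_mod n)"
  proof (rule transI)
    fix x y z assume "(x, y) \<in> cong_mod n" "(y, z) \<in> cong_mod n"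
    then obtain k l :: int where "y - x = of_int k * of_nat n" "z - y = of_int l * of_nat n"
      by (auto simp: cong_mod_def)
    then have "z - x = of_int (k + l) * of_nat n" by (simp add: algebra_simps)
    then show "(x, z) \<in> cong_mod n" unfolding cong_mod_def by blast
  qed
qed auto

text \<open>The circle \<open>\<real>/n\<int>\<close>, with the quotient topology.\<close>

definition circle :: "nat \<Rightarrow> real set set" where
  "circle n = UNIV // cong_mod n"

definition proj :: "nat \<Rightarrow> real \<Rightarrow> real set" where
  "proj n x = cong_mod n `` {x}"

definition circle_topology :: "nat \<Rightarrow> real set topology" where
  "circle_topology n = topology (\<lambda>U. U \<subseteq> circle n \<and> open (proj n -` U))"

lemma proj_eq_iff: "proj n x = proj n y \<longleftrightarrow> (\<exists>k::int. y - x = of_int k * of_nat n)"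
  using eq_equiv_class_iff[OF equiv_cong_mod, of x y n]
  by (simp add: proj_def cong_mod_def)

lemma circle_eq_range: "circle n = range (proj n)"
  by (auto simp: circle_def proj_def quotient_def)

lemma openin_circle_topology:
  "openin (circle_topology n) U \<longleftrightarrow> U \<subseteq> circle n \<and> open (proj n -` U)"
proof -
  have "istopology (\<lambda>U. U \<subseteq> circle n \<and> open (proj n -` U))"
    unfolding istopology_def vimage_Union
    by (intro conjI allI impI) (simp_all add: open_Int le_infI1 Sup_least open_UN)
  then show ?thesis by (simp add: circle_topology_def)
qed

lemma topspace_circle_topology [simp]: "topspace (circle_topology n) = circle n"
proof -
  have "proj n -` circle n = UNIV" by (auto simp: circle_eq_range)
  then have "openin (circle_topology n) (circle n)"
    by (simp add: openin_circle_topology)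
  then show ?thesis
    using openin_subset[of "circle_topology n" "circle n"]
      openin_topspace[of "circle_topology n", unfolded openin_circle_topology]
    by (intro subset_antisym) simp_all
qed

lemma quotient_map_proj: "quotient_map euclideanreal (circle_topology n) (proj n)"
  unfolding quotient_map_def
  by (simp add: openin_circle_topology circle_eq_range vimage_def)

text \<open>
  The map \<open>\<real>/m\<int> \<rightarrow> \<real>/n\<int>\<close> to which \<open>F\<close> descends. It is meaningful only if \<open>F\<close> maps
  congruent reals to congruent reals, since otherwise the image below is not a singleton.
\<close>

definition descend :: "nat \<Rightarrow> nat \<Rightarrow> (real \<Rightarrow> real) \<Rightarrow> real set \<Rightarrow> real set" where
  "descend m n F = (\<lambda>C\<in>circle m. the_elem ((\<lambda>x. proj n (F x)) ` C))"

lemma descend_proj: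
  assumes "\<And>x y. proj m x = proj m y \<Longrightarrow> proj n (F x) = proj n (F y)"
  shows "descend m n F (proj m x) = proj n (F x)"
proof -
  have "proj m x = proj m y" if "y \<in> proj m x" for y
    using that unfolding proj_eq_iff by (simp add: proj_def cong_mod_def)
  then have "proj n (F y) = proj n (F x)" if "y \<in> proj m x" for y
    using assms[of x y] that by simp
  then have "(\<lambda>y. proj n (F y)) ` proj m x = (\<lambda>y. proj n (F x)) ` proj m x"
    by (rule image_cong[OF refl])
  moreover have "x \<in> proj m x"
    by (auto simp: proj_def cong_mod_def intro: exI[of _ 0])
  ultimately have "(\<lambda>y. proj n (F y)) ` proj m x = {proj n (F x)}"
    by (simp only: image_constant)
  then show ?thesis by (simp add: descend_def circle_eq_range)
qed

definition bonding :: "nat \<Rightarrow> nat \<Rightarrow> real set \<Rightarrow> real set" where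
  "bonding m n = descend m n (\<lambda>x. x)"

lemma bonding_proj:
  assumes "n dvd m"
  shows "bonding m n (proj m x) = proj n x"
  unfolding bonding_def
proof (rule descend_proj)
  fix x y assume "proj m x = proj m y"
  then obtain k :: int where k: "y - x = of_int k * of_nat m"
    by (auto simp: proj_eq_iff)
  obtain l where "m = n * l" using assms by blast
  with k have "y - x = of_int (k * int l) * of_nat n" by simp
  then show "proj n x = proj n y" unfolding proj_eq_iff by blast
qed

definition solenoid :: "(nat \<Rightarrow> real set) set" where
  "solenoid = {s \<in> (\<Pi>\<^sub>E n\<in>{1..}. circle n).
     \<forall>m\<ge>1. \<forall>n\<ge>1. n dvd m \<longrightarrow> bonding m n (s m) = s n}"

definition solenoid_topology :: "(nat \<Rightarrow> real set) topology" where
  "solenoid_topology = subtopology (product_topology circle_topology {1..}) solenoid"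

lemma topspace_solenoid_topology [simp]: "topspace solenoid_topology = solenoid"
proof -
  have "solenoid \<subseteq> (\<Pi>\<^sub>E n\<in>{1..}. circle n)"
    unfolding solenoid_def by (rule Collect_restrict)
  then show ?thesis
    by (simp add: solenoid_topology_def Int_absorb1)
qed

text \<open>Extensionality makes a self-map of a subset determined by its values on that subset.\<close>

definition homeos :: "'a topology \<Rightarrow> ('a \<Rightarrow> 'a) set" where
  "homeos X = {f \<in> extensional (topspace X). homeomorphic_map X X f}"

definition is_lift :: "(real \<Rightarrow> real) \<Rightarrow> (real set \<Rightarrow> real set) \<Rightarrow> bool" where
  "is_lift F f \<longleftrightarrow> continuous_on UNIV F \<and> (\<forall>x. proj 1 (F x) = f (proj 1 x))"

text \<open>
  A homeomorphism of \<open>\<real>/\<int>\<close> preserves orientation if it has an increasing lift. Two lifts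
  differ by an integer constant, so the choice of lift is irrelevant.
\<close>

definition Homeo_plus_circle :: "(real set \<Rightarrow> real set) set" where
  "Homeo_plus_circle =
     {f \<in> homeos (circle_topology 1). \<exists>F. is_lift F f \<and> strict_mono F}"

definition Homeo_plus_lifts :: "(real \<Rightarrow> real) set" where
  "Homeo_plus_lifts =
     {F \<in> homeos euclideanreal. \<exists>f\<in>Homeo_plus_circle. is_lift F f}"

definition limit_map :: "(nat \<Rightarrow> real set \<Rightarrow> real set) \<Rightarrow> (nat \<Rightarrow> real set) \<Rightarrow> (nat \<Rightarrow> real set)" where
  "limit_map f = (\<lambda>s\<in>solenoid. \<lambda>n\<in>{1..}. f n (s n))"

definition Homeo_I1 :: "((nat \<Rightarrow> real set) \<Rightarrow> (nat \<Rightarrow> real set)) set" where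
  "Homeo_I1 =
     {f \<in> homeos solenoid_topology.
        \<exists>f\<^sub>1\<in>Homeo_plus_circle. \<exists>F\<^sub>1. is_lift F\<^sub>1 f\<^sub>1 \<and> f = limit_map (\<lambda>n. descend n n F\<^sub>1)}"

text \<open>Both sets consist of bijections, so composition is the multiplication of \<^const>\<open>BijGroup\<close>.\<close>

lemma homeos_subset_Bij: "homeos X \<subseteq> Bij (topspace X)"
proof
  fix f assume "f \<in> homeos X"
  then have f: "f \<in> extensional (topspace X)" "homeomorphic_map X X f"
    by (simp_all add: homeos_def)
  from f(2) have "bij_betw f (topspace X) (topspace X)"
    by (simp add: bij_betw_def homeomorphic_imp_injective_map homeomorphic_imp_surjective_map)
  with f(1) show "f \<in> Bij (topspace X)" by (simp add: Bij_def)
qed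

definition Homeo_I1_group :: "((nat \<Rightarrow> real set) \<Rightarrow> (nat \<Rightarrow> real set)) monoid" where
  "Homeo_I1_group = BijGroup solenoid\<lparr>carrier := Homeo_I1\<rparr>"

definition Homeo_plus_lifts_group :: "(real \<Rightarrow> real) monoid" where
  "Homeo_plus_lifts_group = BijGroup UNIV\<lparr>carrier := Homeo_plus_lifts\<rparr>"

end

(* A lift F of an orientation-preserving circle homeomorphism is the same thing as an increasing
   continuous bijection of the line commuting with x \<mapsto> x + 1: two lifts differ by a continuous
   integer-valued, hence constant, function, and injectivity on the circle forces degree one.
   Such an F commutes with all integer translations, so it descends to every circle and, in the
   limit, to the solenoid, functorially in F. The resulting homomorphism is injective because the
   limit map is known on the image of the line in the solenoid, and a real number divisible by
   every positive integer n vanishes. *)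

theory Submission
  imports Defs
begin

section \<open>Lifts of degree one\<close>

text \<open>A description without a circle map, so that closure under composition and inversion can
  be checked on the line; \<open>Homeo_plus_lifts_eq\<close> identifies it with the lifts.\<close>

definition degree1_lifts :: "(real \<Rightarrow> real) set" where
  "degree1_lifts = {F. continuous_on UNIV F \<and> strict_mono F \<and> surj F \<and> (\<forall>x. F (x + 1) = F x + 1)}"

lemma add_int_of_add_one:
  fixes F :: "real \<Rightarrow> real"
  assumes "\<And>x. F (x + 1) = F x + 1"
  shows "F (x + of_int k) = F x + of_int k"
proof (induction k rule: int_induct[where k = 0])
  case (step1 i)
  then show ?case using assms[of "x + of_int i"] by (simp add: algebra_simps)
next
  case (step2 i)
  then show ?case using assms[of "x + of_int (i - 1)"] by (simp add: algebra_simps)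
qed simp

lemma degree1_lift_add_int:
  "F \<in> degree1_lifts \<Longrightarrow> F (x + of_int k) = F x + of_int k"
  by (rule add_int_of_add_one) (simp add: degree1_lifts_def)

lemma degree1_lift_bij: "F \<in> degree1_lifts \<Longrightarrow> bij F"
  by (simp add: degree1_lifts_def bij_def strict_mono_imp_inj_on)

lemma degree1_lift_id: "(\<lambda>x. x) \<in> degree1_lifts"
  by (simp add: degree1_lifts_def strict_mono_def surj_def)

lemma degree1_lift_comp:
  assumes "F \<in> degree1_lifts" "G \<in> degree1_lifts"
  shows "F \<circ> G \<in> degree1_lifts"
proof -
  have "continuous_on UNIV (F \<circ> G)"
    using assms by (intro continuous_on_compose) (simp_all add: degree1_lifts_def)
  moreover have "strict_mono (F \<circ> G)" "surj (F \<circ> G)"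
    using assms by (simp_all only: degree1_lifts_def mem_Collect_eq strict_mono_o comp_surj)
  ultimately show ?thesis using assms by (simp add: degree1_lifts_def)
qed

lemma degree1_lift_inv:
  assumes "F \<in> degree1_lifts"
  shows "inv_into UNIV F \<in> degree1_lifts"
proof -
  have F: "strict_mono F" "continuous_on UNIV F" "F (x + 1) = F x + 1" for x
    using assms by (simp_all add: degree1_lifts_def)
  have bij: "bij F" by (rule degree1_lift_bij[OF assms])
  then have FI: "F (inv_into UNIV F y) = y" and IF: "inv_into UNIV F (F x) = x" for x y
    by (simp_all add: bij_is_surj surj_f_inv_f bij_is_inj)
  have mono: "strict_mono (inv_into UNIV F)"
    by (rule strict_monoI) (metis F(1) FI strict_mono_less)
  have surj: "surj (inv_into UNIV F)" using bij by (simp add: bij_imp_bij_inv bij_is_surj)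
  \<comment> \<open>Surjectivity makes the range open, and a monotone map with open range has no
    jumps.\<close>
  then have "continuous_on UNIV (inv_into UNIV F)"
    using mono by (intro continuous_onI_mono) (auto simp: strict_mono_less_eq)
  moreover have "inv_into UNIV F (y + 1) = inv_into UNIV F y + 1" for y
    by (metis F(3) FI IF)
  ultimately show ?thesis
    using mono surj by (simp add: degree1_lifts_def)
qed

section \<open>Descent to the circles\<close>

lemma descend_degree1_lift:
  assumes "F \<in> degree1_lifts"
  shows "descend n n F (proj n x) = proj n (F x)"
proof (rule descend_proj)
  fix x y assume "proj n x = proj n y"
  \<comment> \<open>A multiple of \<open>n\<close> is in particular an integer, so \<open>F\<close>
    commutes with this translation.\<close>
  then obtain k :: int where "y = x + of_int (k * int n)"
    by (auto simp: proj_eq_iff algebra_simps)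
  then have "F y - F x = of_int k * of_nat n"
    by (simp only: degree1_lift_add_int[OF assms]) simp
  then show "proj n (F x) = proj n (F y)" unfolding proj_eq_iff by blast
qed

text \<open>By the universal property of the quotient map \<open>proj n\<close>, it suffices to test
  continuity after composing with it, which gives \<open>proj n \<circ> F\<close>.\<close>

lemma continuous_map_descend:
  assumes "F \<in> degree1_lifts"
  shows "continuous_map (circle_topology n) (circle_topology n) (descend n n F)"
proof (rule continuous_compose_quotient_map[OF quotient_map_proj])
  have "continuous_map euclideanreal euclideanreal F"
    using assms by (simp add: degree1_lifts_def)
  then have "continuous_map euclideanreal (circle_topology n) (proj n \<circ> F)"
    by (rule continuous_map_compose) (rule quotient_imp_continuous_map[OF quotient_map_proj])
  then show "continuous_map euclideanreal (circle_topology n) (descend n n F \<circ> proj n)"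
    by (simp add: comp_def descend_degree1_lift[OF assms])
qed

text \<open>Descent is computed on representatives, so descending the inverse of \<open>F\<close>
  gives a two-sided inverse.\<close>

lemma homeomorphic_map_descend:
  assumes "F \<in> degree1_lifts"
  shows "homeomorphic_map (circle_topology n) (circle_topology n) (descend n n F)"
proof -
  have inv: "inv_into UNIV F \<in> degree1_lifts" by (rule degree1_lift_inv[OF assms])
  have "F (inv_into UNIV F x) = x" "inv_into UNIV F (F x) = x" for x
    using degree1_lift_bij[OF assms] by (simp_all add: bij_is_surj surj_f_inv_f bij_is_inj)
  then have "homeomorphic_maps (circle_topology n) (circle_topology n)
      (descend n n F) (descend n n (inv_into UNIV F))"
    using assms inv
    by (auto simp: homeomorphic_maps_def continuous_map_descend circle_eq_range descend_degree1_lift)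
  then show ?thesis by (auto simp: homeomorphic_map_maps)
qed

lemma is_lift_descend:
  assumes "F \<in> degree1_lifts"
  shows "is_lift F (descend 1 1 F)"
  using assms descend_degree1_lift[OF assms, of 1] by (simp add: is_lift_def degree1_lifts_def)

lemma descend_in_Homeo_plus_circle:
  assumes "F \<in> degree1_lifts"
  shows "descend 1 1 F \<in> Homeo_plus_circle"
  using homeomorphic_map_descend[OF assms, of 1] is_lift_descend[OF assms] assms
  by (auto simp: Homeo_plus_circle_def homeos_def degree1_lifts_def descend_def)

section \<open>Lifts of circle homeomorphisms have degree one\<close>

lemma continuous_integer_valued_constant:
  fixes h :: "real \<Rightarrow> real"
  assumes "continuous_on UNIV h" "\<And>x. \<exists>k::int. h x = of_int k"
  shows "\<exists>k::int. \<forall>x. h x = of_int k"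
proof -
  \<comment> \<open>Distinct integers are at distance at least 1, so the values are discrete and
    connectedness of the line forces a constant.\<close>
  have gap: "1 \<le> norm (h y - h x)" if ne: "h y \<noteq> h x" for x y
  proof -
    obtain k l :: int where kl: "h x = of_int k" "h y = of_int l" using assms(2) by metis
    with ne have "1 \<le> \<bar>l - k\<bar>" by auto
    then show ?thesis by (simp add: kl flip: of_int_diff of_int_abs)
  qed
  have "h constant_on UNIV"
    using gap by (intro continuous_discrete_range_constant[OF connected_UNIV assms(1)])
      (metis zero_less_one)
  then show ?thesis using assms(2) by (metis UNIV_I constant_on_def)
qed

text \<open>The difference is continuous and integer-valued. This serves to compare two lifts of one
  map, and a lift with its own translate by 1.\<close>

lemma lift_diff_constant:
  fixes F G :: "real \<Rightarrow> real"
  assumes "continuous_on UNIV F" "continuous_on UNIV G" "\<And>x. proj 1 (F x) = proj 1 (G x)"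
  shows "\<exists>k::int. \<forall>x. G x = F x + of_int k"
proof -
  have "\<exists>k::int. G x - F x = of_int k" for x
    using assms(3)[of x] by (simp add: proj_eq_iff)
  then have "\<exists>k::int. \<forall>x. G x - F x = of_int k"
    using continuous_integer_valued_constant[OF continuous_on_diff[OF assms(2,1)]] by blast
  then show ?thesis by (metis add_diff_cancel_left' diff_add_cancel add.commute)
qed

text \<open>Some lift is increasing, and \<open>F\<close> differs from it by a constant. The degree
  \<open>d\<close> of \<open>F\<close> is positive by monotonicity and at most 1 by injectivity of
  \<open>f\<close>; surjectivity then follows from the intermediate value theorem.\<close>

lemma Homeo_plus_circle_lift:
  assumes f: "f \<in> Homeo_plus_circle" and lift: "is_lift F f"
  shows "F \<in> degree1_lifts"
proof -
  obtain G where G: "is_lift G f" "strict_mono G"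
    using f by (auto simp: Homeo_plus_circle_def)
  have cont: "continuous_on UNIV F" and projF: "proj 1 (F x) = f (proj 1 x)" for x
    using lift by (auto simp: is_lift_def)
  have "\<exists>k::int. \<forall>x. F x = G x + of_int k"
    using G(1) lift by (intro lift_diff_constant) (auto simp: is_lift_def)
  then have mono: "strict_mono F"
    using G(2) by (auto simp: strict_mono_def)
  have proj_add1: "proj 1 (x + 1) = proj 1 x" for x
    unfolding proj_eq_iff by (auto intro: exI[of _ "-1"])
  \<comment> \<open>Both \<open>F\<close> and its translate lift \<open>f\<close>, because
    \<open>x\<close> and \<open>x + 1\<close> are the same point of the circle.\<close>
  have "\<exists>k::int. \<forall>x. F (x + 1) = F x + of_int k"
  proof (rule lift_diff_constant[OF cont])
    show "continuous_on UNIV (\<lambda>x. F (x + 1))"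
      by (intro continuous_on_compose2[OF cont] continuous_intros) simp
    show "proj 1 (F x) = proj 1 (F (x + 1))" for x
      by (simp only: projF proj_add1)
  qed
  then obtain d :: int where d: "F (x + 1) = F x + of_int d" for x by blast
  have "d > 0" using mono d[of 0] by (metis add.commute add.right_neutral less_add_same_cancel1
        of_int_0_less_iff strict_monoD zero_less_one)
  have inj: "inj_on f (circle 1)"
    using f homeomorphic_imp_injective_map
    by (fastforce simp: Homeo_plus_circle_def homeos_def)
  have "d = 1"
  proof (rule ccontr)
    assume "d \<noteq> 1"
    \<comment> \<open>If \<open>d\<close> exceeds 1, then \<open>F\<close> takes the value
      \<open>F 0 + 1\<close> strictly between 0 and 1, and \<open>f\<close> identifies two distinct
      points.\<close>
    with \<open>d > 0\<close> have "F 0 + 1 < F 1" using d[of 0] by simp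
    then obtain y where y: "0 \<le> y" "y \<le> 1" "F y = F 0 + 1"
      using IVT'[of F 0 "F 0 + 1" 1] continuous_on_subset[OF cont, of "{0..1}"] by auto
    then have strict: "0 < y" "y < 1"
      using \<open>F 0 + 1 < F 1\<close> by (auto simp: less_le)
    have "proj 1 (F y) = proj 1 (F 0)"
      using proj_add1[of "F 0"] y(3) by simp
    then have "proj 1 y = proj 1 0"
      using inj_onD[OF inj, of "proj 1 y" "proj 1 0"] by (simp only: projF circle_eq_range rangeI)
    then obtain k :: int where "y = of_int k"
      unfolding proj_eq_iff by (metis diff_0 minus_equation_iff mult.right_neutral of_int_minus of_nat_1)
    with strict show False by auto
  qed
  then have add1: "F (x + 1) = F x + 1" for x using d by simp
  then have add_int: "F (of_int k) = F 0 + of_int k" for k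
    using add_int_of_add_one[of F 0 k] by simp
  have "\<exists>x. F x = y" for y
  proof -
    \<comment> \<open>The floor places \<open>y\<close> between the values of \<open>F\<close> at
      two consecutive integers.\<close>
    define k where "k = \<lfloor>y - F 0\<rfloor>"
    have "F (of_int k) \<le> y" "y \<le> F (of_int (k + 1))"
      unfolding add_int k_def by linarith+
    then show ?thesis
      using IVT'[of F "of_int k" y "of_int (k + 1)"] continuous_on_subset[OF cont]
      by fastforce
  qed
  then have "surj F" by (metis surjI)
  with cont mono add1 show ?thesis by (simp add: degree1_lifts_def)
qed

lemma Homeo_plus_lifts_eq: "Homeo_plus_lifts = degree1_lifts"
proof
  show "Homeo_plus_lifts \<subseteq> degree1_lifts"
    by (auto simp: Homeo_plus_lifts_def intro: Homeo_plus_circle_lift)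
  show "degree1_lifts \<subseteq> Homeo_plus_lifts"
  proof
    fix F assume F: "F \<in> degree1_lifts"
    have "homeomorphic_maps euclideanreal euclideanreal F (inv_into UNIV F)"
      using F degree1_lift_inv[OF F] degree1_lift_bij[OF F]
      by (simp add: homeomorphic_maps_def degree1_lifts_def bij_is_inj bij_is_surj surj_f_inv_f)
    then have "F \<in> homeos euclideanreal"
      by (auto simp: homeos_def homeomorphic_map_maps)
    then show "F \<in> Homeo_plus_lifts"
      using is_lift_descend[OF F] descend_in_Homeo_plus_circle[OF F]
      by (auto simp: Homeo_plus_lifts_def)
  qed
qed

section \<open>Induced maps of the solenoid\<close>

text \<open>The candidate isomorphism, as a function of the lift alone.\<close>

definition induced :: "(real \<Rightarrow> real) \<Rightarrow> (nat \<Rightarrow> real set) \<Rightarrow> (nat \<Rightarrow> real set)" where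
  "induced F = limit_map (\<lambda>n. descend n n F)"

text \<open>The canonical homomorphism from the line to the solenoid; its image is the path
  component of the identity.\<close>

definition line_embedding :: "real \<Rightarrow> nat \<Rightarrow> real set" where
  "line_embedding x = (\<lambda>n\<in>{1..}. proj n x)"

lemma line_embedding_in_solenoid: "line_embedding x \<in> solenoid"
  by (auto simp: line_embedding_def solenoid_def circle_eq_range bonding_proj)

lemma solenoid_component:
  assumes "s \<in> solenoid" "n \<ge> 1"
  obtains x where "s n = proj n x"
proof -
  have "s n \<in> circle n" using assms by (auto simp: solenoid_def)
  then show ?thesis using that by (auto simp: circle_eq_range)
qed

lemma induced_apply:
  "s \<in> solenoid \<Longrightarrow> n \<ge> 1 \<Longrightarrow> induced F s n = descend n n F (s n)"
  by (simp add: induced_def limit_map_def)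

lemma induced_proj:
  assumes "F \<in> degree1_lifts" "s \<in> solenoid" "n \<ge> 1" "s n = proj n x"
  shows "induced F s n = proj n (F x)"
  using assms by (simp add: induced_apply descend_degree1_lift)

lemma induced_extensional: "induced F \<in> extensional solenoid"
  by (simp add: induced_def limit_map_def)

text \<open>If \<open>n\<close> divides \<open>m\<close>, a real \<open>x\<close> representing
  \<open>s m\<close> also represents \<open>s n\<close>, so both components of the image come from
  the same number \<open>F x\<close>.\<close>

lemma induced_in_solenoid:
  assumes F: "F \<in> degree1_lifts" and s: "s \<in> solenoid"
  shows "induced F s \<in> solenoid"
proof -
  have "induced F s n \<in> circle n" if "n \<ge> 1" for n
    using solenoid_component[OF s that] induced_proj[OF F s that] by (metis circle_eq_range rangeI)
  moreover have "bonding m n (induced F s m) = induced F s n"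
    if mn: "m \<ge> 1" "n \<ge> 1" "n dvd m" for m n
  proof -
    obtain x where x: "s m = proj m x" using solenoid_component[OF s mn(1)] .
    have "s n = bonding m n (s m)" using s mn by (simp add: solenoid_def)
    then have "s n = proj n x" using mn(3) by (simp add: x bonding_proj)
    then show ?thesis using x mn by (simp add: induced_proj[OF F s] bonding_proj)
  qed
  moreover have "induced F s \<in> extensional {1..}"
    using s by (simp add: induced_def limit_map_def)
  ultimately show ?thesis by (auto simp: solenoid_def PiE_def)
qed

lemma solenoid_eqI:
  assumes "s \<in> solenoid" "t \<in> solenoid" "\<And>n. n \<ge> 1 \<Longrightarrow> s n = t n"
  shows "s = t"
  using assms by (intro extensionalityI[of s "{1..}" t]) (auto simp: solenoid_def PiE_def)

lemma induced_id:
  assumes "s \<in> solenoid"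
  shows "induced (\<lambda>x. x) s = s"
proof (rule solenoid_eqI)
  fix n :: nat assume n: "n \<ge> 1"
  obtain x where "s n = proj n x" using solenoid_component[OF assms n] .
  then show "induced (\<lambda>x. x) s n = s n"
    using induced_proj[OF degree1_lift_id assms n] by simp
qed (use assms degree1_lift_id induced_in_solenoid in auto)

lemma induced_comp:
  assumes F: "F \<in> degree1_lifts" and G: "G \<in> degree1_lifts" and s: "s \<in> solenoid"
  shows "induced (F \<circ> G) s = induced F (induced G s)"
proof (rule solenoid_eqI)
  fix n :: nat assume n: "n \<ge> 1"
  obtain x where x: "s n = proj n x" using solenoid_component[OF s n] .
  show "induced (F \<circ> G) s n = induced F (induced G s) n"
    using induced_proj[OF degree1_lift_comp[OF F G] s n x] induced_proj[OF G s n x]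
      induced_proj[OF F induced_in_solenoid[OF G s] n] by simp
qed (use assms degree1_lift_comp induced_in_solenoid in auto)

text \<open>The topology is inherited from a product, so each coordinate is checked separately: the
  \<open>n\<close>-th one is a coordinate projection followed by a descended map.\<close>

lemma continuous_map_induced:
  assumes F: "F \<in> degree1_lifts"
  shows "continuous_map solenoid_topology solenoid_topology (induced F)"
proof -
  have "continuous_map solenoid_topology (circle_topology n) (\<lambda>s. induced F s n)"
    if n: "n \<ge> 1" for n
  proof (rule continuous_map_eq)
    have "continuous_map solenoid_topology (circle_topology n) (\<lambda>s. s n)"
      unfolding solenoid_topology_def using n
      by (intro continuous_map_from_subtopology continuous_map_product_projection) simp
    from continuous_map_compose[OF this continuous_map_descend[OF F]]
    show "continuous_map solenoid_topology (circle_topology n) (descend n n F \<circ> (\<lambda>s. s n))" .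
  qed (use n in \<open>simp add: induced_apply\<close>)
  moreover have "induced F ` solenoid \<subseteq> extensional {1..}"
    using induced_in_solenoid[OF F] by (auto simp: solenoid_def PiE_def)
  ultimately have "continuous_map solenoid_topology (product_topology circle_topology {1..}) (induced F)"
    by (simp add: continuous_map_componentwise)
  moreover have "induced F \<in> solenoid \<rightarrow> solenoid"
    using induced_in_solenoid[OF F] by blast
  ultimately show ?thesis
    by (subst (2) solenoid_topology_def) (rule continuous_map_into_subtopology, simp_all)
qed

text \<open>By functoriality, the inverse lift induces the inverse map.\<close>

lemma induced_in_homeos:
  assumes F: "F \<in> degree1_lifts"
  shows "induced F \<in> homeos solenoid_topology"
proof -
  have I: "inv_into UNIV F \<in> degree1_lifts" by (rule degree1_lift_inv[OF F])
  have "F \<circ> inv_into UNIV F = (\<lambda>x. x)" "inv_into UNIV F \<circ> F = (\<lambda>x. x)"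
    using degree1_lift_bij[OF F] by (auto simp: fun_eq_iff bij_is_inj bij_is_surj surj_f_inv_f)
  then have "induced F (induced (inv_into UNIV F) s) = s" "induced (inv_into UNIV F) (induced F s) = s"
    if "s \<in> solenoid" for s
    using induced_comp[OF F I that] induced_comp[OF I F that] induced_id[OF that] by simp_all
  then have "homeomorphic_maps solenoid_topology solenoid_topology (induced F) (induced (inv_into UNIV F))"
    by (simp add: homeomorphic_maps_def continuous_map_induced F I)
  then show ?thesis
    by (auto simp: homeos_def homeomorphic_map_maps induced_extensional)
qed

lemma Homeo_I1_eq: "Homeo_I1 = induced ` degree1_lifts"
proof
  show "Homeo_I1 \<subseteq> induced ` degree1_lifts"
    by (auto simp: Homeo_I1_def induced_def intro: Homeo_plus_circle_lift)
  show "induced ` degree1_lifts \<subseteq> Homeo_I1"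
  proof
    fix f assume "f \<in> induced ` degree1_lifts"
    then obtain F where F: "F \<in> degree1_lifts" "f = induced F" by blast
    then show "f \<in> Homeo_I1"
      using induced_in_homeos[OF F(1)] is_lift_descend[OF F(1)] descend_in_Homeo_plus_circle[OF F(1)]
      unfolding Homeo_I1_def induced_def by blast
  qed
qed

text \<open>At the point of the solenoid given by \<open>x\<close>, equality at level
  \<open>n\<close> says that \<open>F x\<close> and \<open>G x\<close> are congruent modulo
  \<open>n\<close>. A single \<open>n\<close> exceeding their distance forces equality.\<close>

lemma inj_on_induced: "inj_on induced degree1_lifts"
proof (rule inj_onI)
  fix F G assume FG: "F \<in> degree1_lifts" "G \<in> degree1_lifts" and eq: "induced F = induced G"
  show "F = G"
  proof
    fix x
    obtain n :: nat where "\<bar>G x - F x\<bar> < real n" using reals_Archimedean2 by blast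
    \<comment> \<open>The bound is strict and an absolute value is nonnegative, so \<open>n\<close>
      is not 0 and the solenoid has a component there.\<close>
    then have n: "n \<ge> 1" "\<bar>G x - F x\<bar> < real n" by linarith+
    have "line_embedding x n = proj n x" using n by (simp add: line_embedding_def)
    then have "proj n (F x) = proj n (G x)"
      using FG n(1) line_embedding_in_solenoid induced_proj eq by metis
    then obtain k :: int where k: "G x - F x = of_int k * of_nat n"
      by (auto simp: proj_eq_iff)
    with n have "\<bar>of_int k :: real\<bar> < 1" by (simp add: abs_mult)
    then have "k = 0" by linarith
    with k show "F x = G x" by simp
  qed
qed

section \<open>The isomorphism\<close>

text \<open>Over \<open>UNIV\<close> the restrictions built into \<open>BijGroup\<close> are
  vacuous, and its operations become ordinary composition and inversion.\<close>

lemma degree1_lifts_subgroup: "subgroup degree1_lifts (BijGroup UNIV)"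
proof
  show sub: "degree1_lifts \<subseteq> carrier (BijGroup UNIV)"
    by (auto simp: BijGroup_def Bij_def degree1_lift_bij)
  fix F assume F: "F \<in> degree1_lifts"
  then have "F \<in> Bij UNIV" using sub by (auto simp: BijGroup_def)
  then show "inv\<^bsub>BijGroup UNIV\<^esub> F \<in> degree1_lifts"
    using degree1_lift_inv[OF F] by (simp add: inv_BijGroup restrict_UNIV)
  fix G assume G: "G \<in> degree1_lifts"
  then have "G \<in> Bij UNIV" using sub by (auto simp: BijGroup_def)
  with \<open>F \<in> Bij UNIV\<close> show "F \<otimes>\<^bsub>BijGroup UNIV\<^esub> G \<in> degree1_lifts"
    using degree1_lift_comp[OF F G] by (simp add: BijGroup_def compose_def comp_def restrict_UNIV)
qed (use degree1_lift_id in \<open>simp add: BijGroup_def restrict_UNIV\<close>)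

lemma group_Homeo_plus_lifts: "group Homeo_plus_lifts_group"
  unfolding Homeo_plus_lifts_group_def Homeo_plus_lifts_eq
  by (rule subgroup.subgroup_is_group[OF degree1_lifts_subgroup group_BijGroup])

text \<open>The target is the full group \<open>BijGroup solenoid\<close>, so that the group
  structure on \<open>Homeo_I1\<close> can be obtained from the image.\<close>

lemma induced_hom: "induced \<in> hom Homeo_plus_lifts_group (BijGroup solenoid)"
proof (rule homI)
  have Bij: "induced F \<in> Bij solenoid" if "F \<in> degree1_lifts" for F
    using induced_in_homeos[OF that] homeos_subset_Bij[of solenoid_topology] by auto
  then show "induced F \<in> carrier (BijGroup solenoid)"
    if "F \<in> carrier Homeo_plus_lifts_group" for F
    using that by (simp add: Homeo_plus_lifts_group_def Homeo_plus_lifts_eq BijGroup_def)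
  fix F G assume "F \<in> carrier Homeo_plus_lifts_group" "G \<in> carrier Homeo_plus_lifts_group"
  then have FG: "F \<in> degree1_lifts" "G \<in> degree1_lifts"
    by (simp_all add: Homeo_plus_lifts_group_def Homeo_plus_lifts_eq)
  then have "F \<otimes>\<^bsub>Homeo_plus_lifts_group\<^esub> G = F \<circ> G"
    by (simp add: Homeo_plus_lifts_group_def BijGroup_def Bij_def degree1_lift_bij
        compose_def comp_def restrict_UNIV)
  \<comment> \<open>Both sides are extensional, so agreement on \<open>solenoid\<close>
    suffices.\<close>
  moreover have "induced (F \<circ> G) = compose solenoid (induced F) (induced G)"
    using FG by (intro extensionalityI[of _ solenoid])
      (auto simp: induced_extensional induced_comp compose_def)
  ultimately show "induced (F \<otimes>\<^bsub>Homeo_plus_lifts_group\<^esub> G) =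
      induced F \<otimes>\<^bsub>BijGroup solenoid\<^esub> induced G"
    using Bij FG by (simp add: BijGroup_def)
qed

text \<open>The image of a group homomorphism is a subgroup of its target, and here the image is
  \<open>Homeo_I1\<close>.\<close>

lemma group_Homeo_I1: "group Homeo_I1_group"
proof -
  interpret group_hom Homeo_plus_lifts_group "BijGroup solenoid" induced
    by (intro group_hom.intro group_hom_axioms.intro group_Homeo_plus_lifts group_BijGroup induced_hom)
  have "subgroup (induced ` carrier Homeo_plus_lifts_group) (BijGroup solenoid)"
    by (rule img_is_subgroup)
  then have "subgroup Homeo_I1 (BijGroup solenoid)"
    by (simp add: Homeo_plus_lifts_group_def Homeo_plus_lifts_eq Homeo_I1_eq)
  then show ?thesis
    unfolding Homeo_I1_group_def by (rule subgroup.subgroup_is_group[OF _ group_BijGroup])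
qed

lemma induced_iso: "induced \<in> iso Homeo_plus_lifts_group Homeo_I1_group"
proof -
  have carrier: "carrier Homeo_plus_lifts_group = degree1_lifts" "carrier Homeo_I1_group = Homeo_I1"
    by (simp_all add: Homeo_plus_lifts_group_def Homeo_plus_lifts_eq Homeo_I1_group_def)
  have "induced \<in> hom Homeo_plus_lifts_group Homeo_I1_group"
    using induced_hom by (auto simp: hom_def carrier Homeo_I1_eq) (simp add: Homeo_I1_group_def)
  moreover have "bij_betw induced degree1_lifts Homeo_I1"
    by (simp add: bij_betw_def inj_on_induced Homeo_I1_eq)
  ultimately show ?thesis by (simp add: iso_def carrier)
qed

theorem theorem4p3:
  shows "group Homeo_I1_group \<and> group Homeo_plus_lifts_group \<and>
    Homeo_I1_group \<cong> Homeo_plus_lifts_group"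
  using group_Homeo_I1 group_Homeo_plus_lifts induced_iso group.iso_sym is_isoI by blast

end
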